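(* Let $\mathbf{M}$ be the $v\times b$ incidence matrix of a $(v,b,k,r,\lambda)$-BIBD, and let $\mathbf{E}=\mathbf{M}^T$ be the encoding matrix of the gradient code obtained from the dual design, with parameters $N=v$, $K=b$, $L=r$, $R=k$. Let $0\le S<N$ be an integer. Then for any set (of non-stragglers) $\mathcal{F}\subseteq[N]$ of size $N-S$, the vector $$\mathbf{v}_{\mathrm{opt}}=\left(\frac{L}{L+\lambda(N-S-1)}\right)\mathbf{1}_{N-S}$$ is an optimal decoding vector, i.e. it minimizes $\|\mathbf{E}_{\mathcal{F}}\mathbf{v}-\mathbf{1}_K\|_2^2$ over $\mathbf{v}\in\mathbb{R}^{N-S}$, and the worst-case approximation error for $S$ stragglers is $$\mathrm{err}_S(\mathbf{E})=K-\frac{L^2(N-S)}{L+\lambda(N-S-1)}.$$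
   Context: A design is a pair $(X,\mathcal{A})$ where $X=\{x_1,\dots,x_v\}$ is a finite set of points and $\mathcal{A}=\{A_1,\dots,A_b\}$ is a collection of nonempty subsets of $X$ called blocks. Its incidence matrix is the $v\times b$ binary matrix $\mathbf{M}$ with $\mathbf{M}_{i,j}=1$ if $x_i\in A_j$ and $0$ otherwise. A $(v,b,k,r,\lambda)$-balanced incomplete block design (BIBD) is a design with $v$ points and $b$ blocks, each block of size $k$, such that every point is contained in exactly $r$ blocks and any pair of distinct points is contained in exactly $\lambda$ blocks. The dual design of a design with incidence matrix $\mathbf{M}$ is the design with incidence matrix $\mathbf{M}^T$. A gradient code with $N$ workers and $K$ data parts is given by an encoding matrix $\mathbf{E}\in\mathbb{R}^{K\times N}$; $L$ is the maximum number of nonzero entries in a column, $R$ the minimum number of nonzero entries in a row. For $\mathcal{F}\subseteq[N]=\{1,\dots,N\}$, $\mathbf{E}_{\mathcal{F}}$ is the submatrix of the columns indexed by $\mathcal{F}$; $\mathbf{1}_m$ is the $m\times1$ all-ones vector. For $|\mathcal{F}|=N-S$, the approximation error is $\mathrm{err}_{\mathcal{F}}(\mathbf{E})=\min_{\mathbf{v}\in\mathbb{R}^{N-S}}\|\mathbf{E}_{\mathcal{F}}\mathbf{v}-\mathbf{1}_K\|_2^2$, a minimizer is called an optimal decoding vector, and the worst-case approximation error for $S<N$ stragglers is $\mathrm{err}_S(\mathbf{E})=\max_{\mathcal{F}\subseteq[N],\,|\mathcal{F}|=N-S}\mathrm{err}_{\mathcal{F}}(\mathbf{E})$. *)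

theory Defs
  imports Complex_Main "Jordan_Normal_Form.Matrix" "Jordan_Normal_Form.DL_Submatrix"
begin

text \<open>
  A design is given by an enumeration \<open>xs\<close> of its points and an enumeration \<open>As\<close> of its
  blocks. The incidence matrix depends on these enumerations. Points are listed without
  repetition. The same set may occur several times as a block, so blocks are always counted
  by their index.
\<close>

definition design :: "'a list \<Rightarrow> 'a set list \<Rightarrow> bool" where
  "design xs As \<longleftrightarrow> distinct xs \<and> (\<forall>A\<in>set As. A \<noteq> {} \<and> A \<subseteq> set xs)"

definition bibd :: "'a list \<Rightarrow> 'a set list \<Rightarrow> nat \<Rightarrow> nat \<Rightarrow> nat \<Rightarrow> nat \<Rightarrow> nat \<Rightarrow> bool" where
  "bibd xs As v b k r \<Lambda> \<longleftrightarrow>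
     design xs As \<and> length xs = v \<and> length As = b \<and>
     (\<forall>A\<in>set As. card A = k) \<and>
     (\<forall>x\<in>set xs. card {j. j < b \<and> x \<in> As ! j} = r) \<and>
     (\<forall>x\<in>set xs. \<forall>y\<in>set xs. x \<noteq> y \<longrightarrow> card {j. j < b \<and> x \<in> As ! j \<and> y \<in> As ! j} = \<Lambda>)"

definition incidence_matrix :: "'a list \<Rightarrow> 'a set list \<Rightarrow> real mat" where
  "incidence_matrix xs As =
     mat (length xs) (length As) (\<lambda>(i, j). if xs ! i \<in> As ! j then 1 else 0)"

text \<open>
  An encoding matrix \<open>E\<close> has one row per data part and one column per worker. Workers are
  numbered from 0, so \<open>[N]\<close> is \<open>{..<N}\<close>.
\<close>

definition num_workers :: "real mat \<Rightarrow> nat" where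
  "num_workers E = dim_col E"

definition num_parts :: "real mat \<Rightarrow> nat" where
  "num_parts E = dim_row E"

definition max_col_weight :: "real mat \<Rightarrow> nat" where
  "max_col_weight E = Max ((\<lambda>j. card {i. i < dim_row E \<and> E $$ (i, j) \<noteq> 0}) ` {..<dim_col E})"

text \<open>The minimum below is meaningful only if \<open>E\<close> has at least one row.\<close>

definition min_row_weight :: "real mat \<Rightarrow> nat" where
  "min_row_weight E = Min ((\<lambda>i. card {j. j < dim_col E \<and> E $$ (i, j) \<noteq> 0}) ` {..<dim_row E})"

definition ones_vec :: "nat \<Rightarrow> real vec" where
  "ones_vec m = vec m (\<lambda>_. 1)"

definition sq_norm2 :: "real vec \<Rightarrow> real" where
  "sq_norm2 w = (\<Sum>i<dim_vec w. (w $ i)\<^sup>2)"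

definition decoding_residual :: "real mat \<Rightarrow> nat set \<Rightarrow> real vec \<Rightarrow> real" where
  "decoding_residual E F w = sq_norm2 (submatrix E UNIV F *\<^sub>v w - ones_vec (dim_row E))"

definition optimal_decoding_vector :: "real mat \<Rightarrow> nat set \<Rightarrow> real vec \<Rightarrow> bool" where
  "optimal_decoding_vector E F w \<longleftrightarrow>
     is_arg_min (decoding_residual E F) (\<lambda>u. u \<in> carrier_vec (card F)) w"

text \<open>\<open>Min\<close> is not available here, since the set of attained values is infinite in general.\<close>

definition approx_err :: "real mat \<Rightarrow> nat set \<Rightarrow> real" where
  "approx_err E F = (LEAST e. e \<in> decoding_residual E F ` carrier_vec (card F))"

definition worst_case_err :: "real mat \<Rightarrow> nat \<Rightarrow> real" where
  "worst_case_err E S =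
     Max (approx_err E ` {F. F \<subseteq> {..<num_workers E} \<and> card F = num_workers E - S})"

end

(* The workers' columns of the dual design have Gram matrix (r - \<Lambda>) I + \<Lambda> J, whatever the set F of
   non-stragglers. The all-ones vector is an eigenvector of it with eigenvalue r + \<Lambda> (N - S - 1), and
   each column has sum r, so the proposed constant vector solves the normal equations of the
   least-squares problem. The minimum is the same for every F of the given size. *)
theory Submission
  imports Defs
begin

lemma least_squares_pythagoras:
  fixes A :: "'i \<Rightarrow> 'j \<Rightarrow> real"
  assumes "\<And>j. j \<in> J \<Longrightarrow> (\<Sum>i\<in>I. A i j * ((\<Sum>l\<in>J. A i l * u l) - y i)) = 0"
  shows "(\<Sum>i\<in>I. ((\<Sum>j\<in>J. A i j * w j) - y i)\<^sup>2)
    = (\<Sum>i\<in>I. ((\<Sum>j\<in>J. A i j * u j) - y i)\<^sup>2) + (\<Sum>i\<in>I. (\<Sum>j\<in>J. A i j * (w j - u j))\<^sup>2)"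
proof -
  define e where "e i = (\<Sum>j\<in>J. A i j * u j) - y i" for i
  define d where "d i = (\<Sum>j\<in>J. A i j * (w j - u j))" for i
  have "(\<Sum>i\<in>I. d i * e i) = (\<Sum>j\<in>J. (w j - u j) * (\<Sum>i\<in>I. A i j * e i))"
    unfolding d_def sum_distrib_left sum_distrib_right
    by (subst sum.swap) (simp add: mult_ac)
  also have "\<dots> = 0"
    using assms by (simp add: e_def)
  finally have orth: "(\<Sum>i\<in>I. d i * e i) = 0" .
  have "(\<Sum>j\<in>J. A i j * w j) - y i = e i + d i" for i
    by (simp add: e_def d_def algebra_simps sum_subtractf)
  then have "(\<Sum>i\<in>I. ((\<Sum>j\<in>J. A i j * w j) - y i)\<^sup>2)
      = (\<Sum>i\<in>I. (e i)\<^sup>2) + (\<Sum>i\<in>I. (d i)\<^sup>2) + 2 * (\<Sum>i\<in>I. d i * e i)"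
    by (simp add: power2_sum sum.distrib sum_distrib_left mult_ac)
  then show ?thesis
    unfolding orth by (simp add: e_def d_def)
qed

lemma least_squares_minimum:
  fixes A :: "'i \<Rightarrow> 'j \<Rightarrow> real"
  assumes "\<And>j. j \<in> J \<Longrightarrow> (\<Sum>i\<in>I. A i j * ((\<Sum>l\<in>J. A i l * u l) - y i)) = 0"
  shows "(\<Sum>i\<in>I. ((\<Sum>j\<in>J. A i j * u j) - y i)\<^sup>2)
    = (\<Sum>i\<in>I. (y i)\<^sup>2) - (\<Sum>j\<in>J. u j * (\<Sum>i\<in>I. A i j * y i))"
proof -
  define e where "e i = (\<Sum>j\<in>J. A i j * u j) - y i" for i
  have "(\<Sum>i\<in>I. (\<Sum>j\<in>J. A i j * u j) * e i) = (\<Sum>j\<in>J. u j * (\<Sum>i\<in>I. A i j * e i))"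
    unfolding sum_distrib_left sum_distrib_right
    by (subst sum.swap) (simp add: mult_ac)
  also have "\<dots> = 0"
    using assms by (simp add: e_def)
  finally have orth: "(\<Sum>i\<in>I. (\<Sum>j\<in>J. A i j * u j) * e i) = 0" .
  have swap: "(\<Sum>i\<in>I. y i * (\<Sum>j\<in>J. A i j * u j)) = (\<Sum>j\<in>J. u j * (\<Sum>i\<in>I. A i j * y i))"
    unfolding sum_distrib_left sum_distrib_right
    by (subst sum.swap) (simp add: mult_ac)
  have "(e i)\<^sup>2 = (\<Sum>j\<in>J. A i j * u j) * e i - y i * (\<Sum>j\<in>J. A i j * u j) + (y i)\<^sup>2" for i
    by (simp add: e_def power2_eq_square algebra_simps)
  then have "(\<Sum>i\<in>I. (e i)\<^sup>2) = (\<Sum>i\<in>I. (y i)\<^sup>2) - (\<Sum>j\<in>J. u j * (\<Sum>i\<in>I. A i j * y i))"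
    by (simp add: sum.distrib sum_subtractf orth swap)
  then show ?thesis
    by (simp add: e_def)
qed

lemma decoding_residual_eq:
  assumes "F \<subseteq> {..<dim_col E}" and "w \<in> carrier_vec (card F)"
  shows "decoding_residual E F w
    = (\<Sum>i<dim_row E. ((\<Sum>j<card F. E $$ (i, pick F j) * w $ j) - 1)\<^sup>2)"
proof -
  have "{j. j < dim_col E \<and> j \<in> F} = F"
    using assms(1) by auto
  then have "(submatrix E UNIV F *\<^sub>v w - ones_vec (dim_row E)) $ i
      = (\<Sum>j<card F. E $$ (i, pick F j) * w $ j) - 1" if "i < dim_row E" for i
    using that assms(2)
    by (simp add: submatrix_def ones_vec_def scalar_prod_def pick_UNIV lessThan_atLeast0)
  then show ?thesis
    by (simp add: decoding_residual_def sq_norm2_def ones_vec_def)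
qed

lemma approx_err_eq:
  assumes "optimal_decoding_vector E F w"
  shows "approx_err E F = decoding_residual E F w"
  unfolding approx_err_def
  by (rule Least_equality)
    (use assms in \<open>auto simp: optimal_decoding_vector_def is_arg_min_linorder\<close>)

lemma constant_vector_optimal:
  fixes s t c :: real
  assumes F: "F \<subseteq> {..<dim_col E}" "card F = m"
    and diag: "\<And>p. p < dim_col E \<Longrightarrow> (\<Sum>i<dim_row E. E $$ (i, p) * E $$ (i, p)) = s"
    and off_diag: "\<And>p q. \<lbrakk>p < dim_col E; q < dim_col E; p \<noteq> q\<rbrakk>
      \<Longrightarrow> (\<Sum>i<dim_row E. E $$ (i, p) * E $$ (i, q)) = t"
    and col_sum: "\<And>p. p < dim_col E \<Longrightarrow> (\<Sum>i<dim_row E. E $$ (i, p)) = s"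
    and c: "c * (s + t * (real m - 1)) = s"
  shows "optimal_decoding_vector E F (c \<cdot>\<^sub>v ones_vec m)"
    and "approx_err E F = real (dim_row E) - s * real m * c"
proof -
  let ?A = "\<lambda>i j. E $$ (i, pick F j)" and ?I = "{..<dim_row E}" and ?J = "{..<m}"
  have pick_lt: "pick F j < dim_col E" if "j < m" for j
    using pick_in_set_le[of j F] that F by auto
  have pick_neq: "pick F j \<noteq> pick F l" if "j < m" "l < m" "j \<noteq> l" for j l
    using that F(2) by (metis nat_neq_iff pick_mono_le)
  have gram: "(\<Sum>i\<in>?I. ?A i j * ?A i l) = (if l = j then s else t)" if "j < m" "l < m" for j l
    using that pick_lt pick_neq diag off_diag by auto
  have normal: "(\<Sum>i\<in>?I. ?A i j * ((\<Sum>l\<in>?J. ?A i l * c) - 1)) = 0" if "j \<in> ?J" for j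
  proof -
    have j: "j < m"
      using that by simp
    have "(\<Sum>i\<in>?I. ?A i j * ((\<Sum>l\<in>?J. ?A i l * c) - 1))
        = c * (\<Sum>l\<in>?J. \<Sum>i\<in>?I. ?A i j * ?A i l) - (\<Sum>i\<in>?I. ?A i j)"
      by (subst sum.swap) (simp add: sum_subtractf sum_distrib_left algebra_simps)
    also have "(\<Sum>l\<in>?J. \<Sum>i\<in>?I. ?A i j * ?A i l) = (\<Sum>l\<in>?J. if l = j then s else t)"
      using gram j by (intro sum.cong) auto
    also have "\<dots> = s + t * (real m - 1)"
      using j by (subst sum.remove[of _ j]) (auto simp: of_nat_diff)
    also have "(\<Sum>i\<in>?I. ?A i j) = s"
      using col_sum pick_lt j by simp
    finally show ?thesis
      using c by simp
  qed
  have res: "decoding_residual E F w = (\<Sum>i\<in>?I. ((\<Sum>j\<in>?J. ?A i j * w $ j) - 1)\<^sup>2)"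
    if "w \<in> carrier_vec m" for w
    using decoding_residual_eq[OF F(1)] F(2) that by simp
  have carr: "c \<cdot>\<^sub>v ones_vec m \<in> carrier_vec m"
    by (simp add: ones_vec_def)
  have res_c: "decoding_residual E F (c \<cdot>\<^sub>v ones_vec m)
      = (\<Sum>i\<in>?I. ((\<Sum>j\<in>?J. ?A i j * c) - 1)\<^sup>2)"
    using res[OF carr] by (simp add: ones_vec_def)
  have "decoding_residual E F (c \<cdot>\<^sub>v ones_vec m) \<le> decoding_residual E F w"
    if "w \<in> carrier_vec m" for w
    unfolding res_c res[OF that]
    by (subst (2) least_squares_pythagoras[where u = "\<lambda>_. c", OF normal])
      (auto intro: sum_nonneg)
  then show opt: "optimal_decoding_vector E F (c \<cdot>\<^sub>v ones_vec m)"
    using carr by (simp add: optimal_decoding_vector_def is_arg_min_linorder F(2))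
  have "decoding_residual E F (c \<cdot>\<^sub>v ones_vec m)
      = real (dim_row E) - (\<Sum>j\<in>?J. c * (\<Sum>i\<in>?I. ?A i j))"
    unfolding res_c by (subst least_squares_minimum[OF normal]) simp_all
  also have "(\<Sum>j\<in>?J. c * (\<Sum>i\<in>?I. ?A i j)) = s * real m * c"
    using col_sum pick_lt by simp
  finally show "approx_err E F = real (dim_row E) - s * real m * c"
    using approx_err_eq[OF opt] by simp
qed

context
  fixes xs :: "'a list" and As :: "'a set list" and v b k r \<Lambda> :: nat
  assumes bibd: "bibd xs As v b k r \<Lambda>"
begin

abbreviation (input) "dual_matrix \<equiv> transpose_mat (incidence_matrix xs As)"

lemma dim_dual_matrix: "dim_row dual_matrix = b" "dim_col dual_matrix = v"
  using bibd by (auto simp: bibd_def incidence_matrix_def)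

lemma dual_matrix_index:
  "i < b \<Longrightarrow> j < v \<Longrightarrow> dual_matrix $$ (i, j) = of_bool (xs ! j \<in> As ! i)"
  using bibd by (auto simp: bibd_def incidence_matrix_def)

lemma card_blocks_containing:
  "p < v \<Longrightarrow> card {i. i < b \<and> xs ! p \<in> As ! i} = r"
  using bibd by (auto simp: bibd_def)

lemma card_points_of_block:
  assumes "i < b"
  shows "card {j. j < v \<and> xs ! j \<in> As ! i} = k"
proof -
  have A: "As ! i \<subseteq> set xs" "card (As ! i) = k" and xs: "distinct xs" "length xs = v"
    using bibd assms by (auto simp: bibd_def design_def)
  have "(!) xs ` {j. j < v \<and> xs ! j \<in> As ! i} = As ! i"
    using A(1) xs(2) by (auto simp: subset_iff in_set_conv_nth)
  moreover have "inj_on ((!) xs) {j. j < v \<and> xs ! j \<in> As ! i}"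
    using xs by (auto simp: inj_on_def nth_eq_iff_index_eq)
  ultimately show ?thesis
    using A(2) card_image by metis
qed

lemma dual_matrix_col_sum:
  "p < v \<Longrightarrow> (\<Sum>i<b. dual_matrix $$ (i, p)) = real r"
  by (simp add: dual_matrix_index Int_def flip: card_blocks_containing)

lemma dual_matrix_gram_diag:
  "p < v \<Longrightarrow> (\<Sum>i<b. dual_matrix $$ (i, p) * dual_matrix $$ (i, p)) = real r"
  using dual_matrix_col_sum by (simp add: dual_matrix_index)

lemma dual_matrix_gram_off_diag:
  assumes "p < v" "q < v" "p \<noteq> q"
  shows "(\<Sum>i<b. dual_matrix $$ (i, p) * dual_matrix $$ (i, q)) = real \<Lambda>"
proof -
  have "xs ! p \<noteq> xs ! q" "xs ! p \<in> set xs" "xs ! q \<in> set xs"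
    using assms bibd by (auto simp: bibd_def design_def nth_eq_iff_index_eq)
  then have "card {i. i < b \<and> xs ! p \<in> As ! i \<and> xs ! q \<in> As ! i} = \<Lambda>"
    using bibd by (auto simp: bibd_def)
  then show ?thesis
    using assms by (simp add: dual_matrix_index Int_def flip: of_bool_conj)
qed

lemma max_col_weight_dual_matrix:
  assumes "v > 0"
  shows "max_col_weight dual_matrix = r"
proof -
  have "card {i. i < b \<and> dual_matrix $$ (i, j) \<noteq> 0} = r" if "j < v" for j
    using card_blocks_containing[OF that] that
    by (simp add: dual_matrix_index cong: conj_cong)
  then have "(\<lambda>j. card {i. i < b \<and> dual_matrix $$ (i, j) \<noteq> 0}) ` {..<v} = {r}"
    using assms by (auto simp: image_iff)
  then show ?thesis
    unfolding max_col_weight_def dim_dual_matrix by simp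
qed

lemma min_row_weight_dual_matrix:
  assumes "b > 0"
  shows "min_row_weight dual_matrix = k"
proof -
  have "card {j. j < v \<and> dual_matrix $$ (i, j) \<noteq> 0} = k" if "i < b" for i
    using card_points_of_block[OF that] that
    by (simp add: dual_matrix_index cong: conj_cong)
  then have "(\<lambda>i. card {j. j < v \<and> dual_matrix $$ (i, j) \<noteq> 0}) ` {..<b} = {k}"
    using assms by (auto simp: image_iff)
  then show ?thesis
    unfolding min_row_weight_def dim_dual_matrix by simp
qed

end

theorem theorem2:
  fixes xs :: "'a list" and As :: "'a set list"
    and v b k r \<Lambda> N K L R S :: nat and E :: "real mat"
  assumes "bibd xs As v b k r \<Lambda>"
    and "E = transpose_mat (incidence_matrix xs As)"
    and "N = num_workers E"
    and "K = num_parts E"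
    and "L = max_col_weight E"
    and "R = min_row_weight E"
    and "S < N"
  shows "(N = v \<and> K = b \<and> L = r \<and> (b > 0 \<longrightarrow> R = k)) \<and>
    (\<forall>F. F \<subseteq> {..<N} \<and> card F = N - S \<longrightarrow>
       optimal_decoding_vector E F
         ((real L / (real L + real \<Lambda> * (real N - real S - 1))) \<cdot>\<^sub>v ones_vec (N - S))) \<and>
    worst_case_err E S
      = real K - (real L)\<^sup>2 * (real N - real S) / (real L + real \<Lambda> * (real N - real S - 1))"
proof (intro conjI allI impI)
  note design = assms(1)
  have dims: "dim_row E = b" "dim_col E = v"
    using dim_dual_matrix[OF design] by (simp_all add: assms(2))
  show N: "N = v" and K: "K = b"
    using assms(3,4) dims by (simp_all add: num_workers_def num_parts_def)
  show L: "L = r"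
    using max_col_weight_dual_matrix[OF design] assms(2,5,7) N by simp
  show "R = k" if "b > 0"
    using min_row_weight_dual_matrix[OF design that] assms(2,6) by simp
  define c where "c = real L / (real L + real \<Lambda> * (real N - real S - 1))"
  have m: "real (N - S) = real N - real S"
    using assms(7) by simp
  have c: "c * (real r + real \<Lambda> * (real (N - S) - 1)) = real r"
  proof (cases "r = 0")
    case False
    then have "real r + real \<Lambda> * (real (N - S) - 1) > 0"
      using assms(7) by (intro add_pos_nonneg mult_nonneg_nonneg) auto
    then show ?thesis
      by (simp add: c_def L m)
  qed (simp add: c_def L)
  have F_facts: "optimal_decoding_vector E F (c \<cdot>\<^sub>v ones_vec (N - S))"
      "approx_err E F = real b - real r * real (N - S) * c"
    if "F \<subseteq> {..<N} \<and> card F = N - S" for F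
    using constant_vector_optimal[of F E "N - S" "real r" "real \<Lambda>" c] that c dims N
      dual_matrix_gram_diag[OF design] dual_matrix_gram_off_diag[OF design]
      dual_matrix_col_sum[OF design] assms(2)
    by auto
  show "optimal_decoding_vector E F
      ((real L / (real L + real \<Lambda> * (real N - real S - 1))) \<cdot>\<^sub>v ones_vec (N - S))"
    if "F \<subseteq> {..<N} \<and> card F = N - S" for F
    using F_facts(1)[OF that] by (simp add: c_def)
  have "approx_err E ` {F. F \<subseteq> {..<N} \<and> card F = N - S} = {real b - real r * real (N - S) * c}"
    using F_facts(2) by (auto simp: image_iff intro!: exI[of _ "{..<N - S}"])
  then show "worst_case_err E S
      = real K - (real L)\<^sup>2 * (real N - real S) / (real L + real \<Lambda> * (real N - real S - 1))"
    by (simp add: worst_case_err_def c_def K L m power2_eq_square mult_ac flip: assms(3))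
qed

end
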